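(* Let $X$ and $B$ be finite and walkable graphs, and suppose $B$ is separated and basal. Then $X$ and $B$ are topologically N-equivalent if and only if they are N-equivalent.
   Context: A graph is $X=(X_0,X_1,s,t)$ with a set $X_0$ of nodes, a set $X_1$ of arcs, and functions $s,t:X_1\to X_0$ (source and target); loops and multiple arcs are allowed. It is finite if $X_0$ and $X_1$ are finite. Graph morphisms are pairs of functions on nodes and arcs commuting with $s$ and $t$. $\mathbf{N}$ is the graph with nodes the natural numbers and arcs $(n,n+1)$ from $n$ to $n+1$; a walk in $X$ is a graph morphism $\mathbf{N}\to X$, and its source is the image of node $0$. $N(X)$ is the set of walks in $X$ together with the shift $\tau:N(X)\to N(X)$ deleting the first arc of a walk; a map of N-sets is a function commuting with $\tau$. $N(X)$ is topologized by taking as basis the sets $U_n(\omega)$ ($\omega\in N(X)$, $n\ge 0$) of walks which agree with $\omega$ for the first $n$ steps (that is, have the same initial path of length $n$; for $n=0$, the same source). Graphs $X$ and $Y$ are N-equivalent when there is an isomorphism of N-sets $N(X)\to N(Y)$ (equivalently, they are homotopy-equivalent for the N-equivalence model structure); they are topologically N-equivalent when there is an isomorphism of N-sets $N(X)\to N(Y)$ which is a homeomorphism (a topological conjugacy). $X$ is walkable when it equals its walkable subgraph (the subgraph of nodes and arcs that occur as the first node, resp. first arc, of a walk in $X$), equivalently when every node is the source of some walk. $X( *,x)$ is the set of arcs of $X$ with target $x$. A graph morphism $f:X\to Y$ is a covering when $f:X( *,x)\to Y( *,f(x))$ is a bijection for every node $x$; an epic covering is a covering surjective on nodes. A graph $B$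 is basal when the only epic coverings $B\to B'$ are isomorphisms. A graph is separated when it has no two distinct arcs $a,a'$ with $s(a)=s(a')$ and $t(a)=t(a')$. *)

theory Defs
  imports "HOL-Analysis.Abstract_Topology" "Graph_Theory.Digraph"
begin

text \<open>
  Graphs are the directed multigraphs \<^typ>\<open>('a, 'b) pre_digraph\<close> satisfying
  \<^locale>\<open>wf_digraph\<close> (loops, multiple arcs and the empty graph are allowed; tail is the
  source, head is the target).  Finite graphs are \<^locale>\<open>fin_digraph\<close>, and separated
  graphs are \<^locale>\<open>nomulti_digraph\<close>.

  A morphism is a pair of a node map and an arc map.  Values outside \<^const>\<open>verts\<close> and
  \<^const>\<open>arcs\<close> are irrelevant.
\<close>

definition graph_morphism ::
  "('a, 'b) pre_digraph \<Rightarrow> ('c, 'd) pre_digraph \<Rightarrow> ('a \<Rightarrow> 'c) \<times> ('b \<Rightarrow> 'd) \<Rightarrow> bool" where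
  "graph_morphism X Y f \<longleftrightarrow>
     fst f ` verts X \<subseteq> verts Y \<and> snd f ` arcs X \<subseteq> arcs Y \<and>
     (\<forall>a\<in>arcs X. tail Y (snd f a) = fst f (tail X a) \<and> head Y (snd f a) = fst f (head X a))"

definition graph_isomorphism ::
  "('a, 'b) pre_digraph \<Rightarrow> ('c, 'd) pre_digraph \<Rightarrow> ('a \<Rightarrow> 'c) \<times> ('b \<Rightarrow> 'd) \<Rightarrow> bool" where
  "graph_isomorphism X Y f \<longleftrightarrow>
     graph_morphism X Y f \<and> bij_betw (fst f) (verts X) (verts Y) \<and> bij_betw (snd f) (arcs X) (arcs Y)"

text \<open>
  The arc from \<open>n\<close> to \<open>n + 1\<close> is named by \<open>n\<close> itself, so that nodes and arcs both fill the
  whole type \<^typ>\<open>nat\<close>, and equality of morphisms out of this graph is equality of pairs of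
  functions.
\<close>

definition nat_graph :: "(nat, nat) pre_digraph" where
  "nat_graph = \<lparr>verts = UNIV, arcs = UNIV, tail = (\<lambda>n. n), head = Suc\<rparr>"

type_synonym ('a, 'b) walk = "(nat \<Rightarrow> 'a) \<times> (nat \<Rightarrow> 'b)"

definition walks :: "('a, 'b) pre_digraph \<Rightarrow> ('a, 'b) walk set" where
  "walks X = {\<omega>. graph_morphism nat_graph X \<omega>}"

definition walk_source :: "('a, 'b) walk \<Rightarrow> 'a" where
  "walk_source \<omega> = fst \<omega> 0"

definition first_arc :: "('a, 'b) walk \<Rightarrow> 'b" where
  "first_arc \<omega> = snd \<omega> 0"

definition shift :: "('a, 'b) walk \<Rightarrow> ('a, 'b) walk" where
  "shift \<omega> = (\<lambda>n. fst \<omega> (Suc n), \<lambda>n. snd \<omega> (Suc n))"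

definition walk_nbhd :: "('a, 'b) pre_digraph \<Rightarrow> nat \<Rightarrow> ('a, 'b) walk \<Rightarrow> ('a, 'b) walk set" where
  "walk_nbhd X n \<omega> =
     {\<omega>' \<in> walks X. (\<forall>i\<le>n. fst \<omega>' i = fst \<omega> i) \<and> (\<forall>i<n. snd \<omega>' i = snd \<omega> i)}"

definition walk_topology :: "('a, 'b) pre_digraph \<Rightarrow> ('a, 'b) walk topology" where
  "walk_topology X = topology_generated_by {walk_nbhd X n \<omega> | n \<omega>. \<omega> \<in> walks X}"

definition nset_map :: "('p set \<times> ('p \<Rightarrow> 'p)) \<Rightarrow> ('q set \<times> ('q \<Rightarrow> 'q)) \<Rightarrow> ('p \<Rightarrow> 'q) \<Rightarrow> bool" where
  "nset_map P Q h \<longleftrightarrow> h ` fst P \<subseteq> fst Q \<and> (\<forall>p\<in>fst P. h (snd P p) = snd Q (h p))"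

definition nset_isomorphism ::
  "('p set \<times> ('p \<Rightarrow> 'p)) \<Rightarrow> ('q set \<times> ('q \<Rightarrow> 'q)) \<Rightarrow> ('p \<Rightarrow> 'q) \<Rightarrow> bool" where
  "nset_isomorphism P Q h \<longleftrightarrow> nset_map P Q h \<and> bij_betw h (fst P) (fst Q)"

definition walk_nset ::
  "('a, 'b) pre_digraph \<Rightarrow> ('a, 'b) walk set \<times> (('a, 'b) walk \<Rightarrow> ('a, 'b) walk)" where
  "walk_nset X = (walks X, shift)"

definition N_equivalent :: "('a, 'b) pre_digraph \<Rightarrow> ('c, 'd) pre_digraph \<Rightarrow> bool" where
  "N_equivalent X Y \<longleftrightarrow> (\<exists>h. nset_isomorphism (walk_nset X) (walk_nset Y) h)"

definition topologically_N_equivalent ::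
  "('a, 'b) pre_digraph \<Rightarrow> ('c, 'd) pre_digraph \<Rightarrow> bool" where
  "topologically_N_equivalent X Y \<longleftrightarrow>
     (\<exists>h. nset_isomorphism (walk_nset X) (walk_nset Y) h \<and>
          homeomorphic_map (walk_topology X) (walk_topology Y) h)"

definition walkable_subgraph :: "('a, 'b) pre_digraph \<Rightarrow> ('a, 'b) pre_digraph" where
  "walkable_subgraph X =
     \<lparr>verts = walk_source ` walks X, arcs = first_arc ` walks X, tail = tail X, head = head X\<rparr>"

definition walkable :: "('a, 'b) pre_digraph \<Rightarrow> bool" where
  "walkable X \<longleftrightarrow> X = walkable_subgraph X"

definition covering ::
  "('a, 'b) pre_digraph \<Rightarrow> ('c, 'd) pre_digraph \<Rightarrow> ('a \<Rightarrow> 'c) \<times> ('b \<Rightarrow> 'd) \<Rightarrow> bool" where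
  "covering X Y f \<longleftrightarrow> graph_morphism X Y f \<and>
     (\<forall>x\<in>verts X. bij_betw (snd f) (in_arcs X x) (in_arcs Y (fst f x)))"

definition epic_covering ::
  "('a, 'b) pre_digraph \<Rightarrow> ('c, 'd) pre_digraph \<Rightarrow> ('a \<Rightarrow> 'c) \<times> ('b \<Rightarrow> 'd) \<Rightarrow> bool" where
  "epic_covering X Y f \<longleftrightarrow> covering X Y f \<and> fst f ` verts X = verts Y"

text \<open>
  A definition cannot quantify over types, so the target \<open>B'\<close> ranges over graphs whose nodes and
  arcs have the same types as those of \<open>B\<close>.  This is no restriction: epic coverings are
  surjective on nodes and arcs, and lemma \<open>basal_imp\<close> below shows that the condition then holds for
  targets over arbitrary types.
\<close>

definition basal :: "('a, 'b) pre_digraph \<Rightarrow> bool" where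
  "basal B \<longleftrightarrow>
     (\<forall>(B' :: ('a, 'b) pre_digraph) f. wf_digraph B' \<longrightarrow> epic_covering B B' f \<longrightarrow> graph_isomorphism B B' f)"

lemma epic_covering_arcs:
  assumes "wf_digraph Y" "epic_covering X Y f"
  shows "snd f ` arcs X = arcs Y"
proof
  show "snd f ` arcs X \<subseteq> arcs Y"
    using assms(2) by (simp add: epic_covering_def covering_def graph_morphism_def)
  show "arcs Y \<subseteq> snd f ` arcs X"
  proof
    fix b assume b: "b \<in> arcs Y"
    with assms(1) have "head Y b \<in> verts Y" by (rule wf_digraph.head_in_verts)
    then obtain x where x: "x \<in> verts X" "fst f x = head Y b"
      using assms(2) unfolding epic_covering_def by (metis imageE)
    then have "bij_betw (snd f) (in_arcs X x) (in_arcs Y (head Y b))"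
      using assms(2) unfolding epic_covering_def covering_def by metis
    moreover have "b \<in> in_arcs Y (head Y b)" using b by simp
    ultimately have "b \<in> snd f ` in_arcs X x" by (simp add: bij_betw_def)
    then show "b \<in> snd f ` arcs X" by (auto simp: in_arcs_def)
  qed
qed

lemma basal_imp:
  fixes B :: "('a, 'b) pre_digraph" and B' :: "('c, 'd) pre_digraph"
  assumes basal: "basal B" and wf: "wf_digraph B'" and epi: "epic_covering B B' f"
  shows "graph_isomorphism B B' f"
proof -
  let ?v = "fst f" and ?a = "snd f"
  define gv where "gv = inv_into (verts B) ?v"
  define ga where "ga = inv_into (arcs B) ?a"
  have V: "?v ` verts B = verts B'" using epi by (simp add: epic_covering_def)
  have A: "?a ` arcs B = arcs B'" using wf epi by (rule epic_covering_arcs)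
  have mor: "graph_morphism B B' f" using epi by (simp add: epic_covering_def covering_def)
  then have ends: "tail B' (?a e) = ?v (tail B e)" "head B' (?a e) = ?v (head B e)"
    if "e \<in> arcs B" for e
    using that by (simp_all add: graph_morphism_def)
  have vg: "?v (gv y) = y" if "y \<in> verts B'" for y
    unfolding gv_def using that V by (simp add: f_inv_into_f)
  have ag: "?a (ga e) = e" if "e \<in> arcs B'" for e
    unfolding ga_def using that A by (simp add: f_inv_into_f)
  define C :: "('a, 'b) pre_digraph" where
    "C = \<lparr>verts = gv ` verts B', arcs = ga ` arcs B',
          tail = (\<lambda>e. gv (tail B' (?a e))), head = (\<lambda>e. gv (head B' (?a e)))\<rparr>"
  let ?f = "(gv \<circ> ?v, ga \<circ> ?a)"
  have wfC: "wf_digraph C"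
    by unfold_locales (auto simp: C_def ag wf_digraph.tail_in_verts[OF wf] wf_digraph.head_in_verts[OF wf])
  have morC: "graph_morphism B C ?f"
  proof -
    have "?v x \<in> verts B'" if "x \<in> verts B" for x using that V by blast
    moreover have aB: "?a e \<in> arcs B'" if "e \<in> arcs B" for e using that A by blast
    ultimately show ?thesis
      unfolding graph_morphism_def C_def by (auto simp: ag[OF aB] ends)
  qed
  have "bij_betw (ga \<circ> ?a) (in_arcs B x) (in_arcs C (gv (?v x)))" if x: "x \<in> verts B" for x
  proof (rule bij_betw_trans)
    show "bij_betw ?a (in_arcs B x) (in_arcs B' (?v x))"
      using epi x by (simp add: epic_covering_def covering_def)
    have vx: "?v x \<in> verts B'" using V x by blast
    show "bij_betw ga (in_arcs B' (?v x)) (in_arcs C (gv (?v x)))"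
    proof (rule bij_betw_imageI)
      show "inj_on ga (in_arcs B' (?v x))"
        by (rule inj_on_inverseI[of _ ?a]) (auto simp: ag)
      have "head B' e = ?v x \<longleftrightarrow> gv (head B' e) = gv (?v x)" if "e \<in> arcs B'" for e
        using vg[OF wf_digraph.head_in_verts[OF wf that]] vg[OF vx] by metis
      then have "in_arcs B' (?v x) = {e \<in> arcs B'. gv (head B' e) = gv (?v x)}"
        unfolding in_arcs_def by blast
      moreover have "in_arcs C (gv (?v x)) = ga ` {e \<in> arcs B'. gv (head B' e) = gv (?v x)}"
        by (auto simp: C_def in_arcs_def ag)
      ultimately show "ga ` in_arcs B' (?v x) = in_arcs C (gv (?v x))" by simp
    qed
  qed
  moreover have "(gv \<circ> ?v) ` verts B = verts C"
    unfolding C_def image_comp[symmetric] V by simp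
  ultimately have "epic_covering B C ?f"
    unfolding epic_covering_def covering_def using morC by simp
  then have "graph_isomorphism B C ?f"
    using basal wfC unfolding basal_def by blast
  then have "inj_on ?v (verts B)" "inj_on ?a (arcs B)"
    unfolding graph_isomorphism_def bij_betw_def fst_conv snd_conv by (blast dest: inj_on_imageI2)+
  with mor V A show ?thesis by (simp add: graph_isomorphism_def bij_betw_def)
qed

text \<open>The neighbourhoods \<^const>\<open>walk_nbhd\<close> are a basis of \<^const>\<open>walk_topology\<close>, not only a subbasis.\<close>

lemma walk_nbhd_eqI:
  assumes "\<omega>' \<in> walk_nbhd X n \<omega>"
  shows "walk_nbhd X n \<omega>' = walk_nbhd X n \<omega>"
  using assms by (auto simp: walk_nbhd_def)

lemma walk_nbhd_self: "\<omega> \<in> walks X \<Longrightarrow> \<omega> \<in> walk_nbhd X n \<omega>"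
  by (simp add: walk_nbhd_def)

lemma walk_nbhd_antimono: "m \<le> n \<Longrightarrow> walk_nbhd X n \<omega> \<subseteq> walk_nbhd X m \<omega>"
  by (auto simp: walk_nbhd_def)

lemma topspace_walk_topology: "topspace (walk_topology X) = walks X"
proof -
  have "\<Union> {walk_nbhd X n \<omega> | n \<omega>. \<omega> \<in> walks X} = walks X"
  proof (intro equalityI subsetI)
    fix \<omega> assume "\<omega> \<in> walks X"
    then show "\<omega> \<in> \<Union> {walk_nbhd X n \<omega> | n \<omega>. \<omega> \<in> walks X}"
      using walk_nbhd_self[of \<omega> X 0] by blast
  qed (auto simp: walk_nbhd_def)
  then show ?thesis by (simp only: walk_topology_def topology_generated_by_topspace)
qed

lemma openin_walk_topology:
  "openin (walk_topology X) U \<longleftrightarrow>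
     U \<subseteq> walks X \<and> (\<forall>\<omega>\<in>U. \<exists>n. walk_nbhd X n \<omega> \<subseteq> U)"
proof (intro iffI conjI)
  assume U: "openin (walk_topology X) U"
  then show "U \<subseteq> walks X" by (metis openin_subset topspace_walk_topology)
  from U have "generate_topology_on {walk_nbhd X n \<omega> | n \<omega>. \<omega> \<in> walks X} U"
    by (simp add: walk_topology_def openin_topology_generated_by_iff)
  then show "\<forall>\<omega>\<in>U. \<exists>n. walk_nbhd X n \<omega> \<subseteq> U"
  proof induction
    case Empty
    then show ?case by simp
  next
    case (Int a b)
    show ?case
    proof
      fix \<omega> assume "\<omega> \<in> a \<inter> b"
      with Int.IH obtain m n where "walk_nbhd X m \<omega> \<subseteq> a" "walk_nbhd X n \<omega> \<subseteq> b" by blast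
      then have "walk_nbhd X (max m n) \<omega> \<subseteq> a \<inter> b"
        using walk_nbhd_antimono[of m "max m n" X \<omega>] walk_nbhd_antimono[of n "max m n" X \<omega>] by auto
      then show "\<exists>n. walk_nbhd X n \<omega> \<subseteq> a \<inter> b" ..
    qed
  next
    case (UN K)
    show ?case
    proof
      fix \<omega> assume "\<omega> \<in> \<Union> K"
      then obtain k where k: "k \<in> K" "\<omega> \<in> k" by blast
      with UN.IH obtain n where "walk_nbhd X n \<omega> \<subseteq> k" by blast
      with k(1) show "\<exists>n. walk_nbhd X n \<omega> \<subseteq> \<Union> K" by blast
    qed
  next
    case (Basis s)
    then obtain n \<omega> where s: "s = walk_nbhd X n \<omega>" by blast
    show ?case
    proof
      fix \<omega>' assume "\<omega>' \<in> s"
      then have "walk_nbhd X n \<omega>' = s" unfolding s by (rule walk_nbhd_eqI)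
      then show "\<exists>n. walk_nbhd X n \<omega>' \<subseteq> s" by blast
    qed
  qed
next
  assume U: "U \<subseteq> walks X \<and> (\<forall>\<omega>\<in>U. \<exists>n. walk_nbhd X n \<omega> \<subseteq> U)"
  show "openin (walk_topology X) U"
  proof (subst openin_subopen, intro ballI)
    fix \<omega> assume w: "\<omega> \<in> U"
    with U obtain n where n: "walk_nbhd X n \<omega> \<subseteq> U" by blast
    have "openin (walk_topology X) (walk_nbhd X n \<omega>)"
      unfolding walk_topology_def using U w by (intro topology_generated_by_Basis) blast
    moreover have "\<omega> \<in> walk_nbhd X n \<omega>" using w U by (intro walk_nbhd_self) blast
    ultimately show "\<exists>T. openin (walk_topology X) T \<and> \<omega> \<in> T \<and> T \<subseteq> U"
      using n by blast
  qed
qed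

end

(*
  Proof idea.  The fibre of the shift over a walk is the set of arcs entering its source, so an
  isomorphism h of N-sets identifies the trees of backward paths at the source of w and at the
  source of h w.  Distinct nodes of a basal graph have non-isomorphic backward trees, hence the
  source of h w depends only on the source of w.  Commuting with the shift, h then acts node by
  node, and as B is separated the nodes of h w determine its arcs.  So h is continuous, and a
  continuous bijection from a compact space to a Hausdorff space is a homeomorphism.
*)
theory Submission
  imports Defs "HOL-Analysis.T1_Spaces"
begin

section \<open>Equivalence of nodes with isomorphic backward trees\<close>

text \<open>Coinductively, two nodes are related when their trees of backward paths are isomorphic.\<close>

coinductive in_bisimilar :: "('a, 'b) pre_digraph \<Rightarrow> 'a \<Rightarrow> 'a \<Rightarrow> bool" for G where
  "bij_betw \<sigma> (in_arcs G x) (in_arcs G y) \<Longrightarrow>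
   (\<And>a. a \<in> in_arcs G x \<Longrightarrow> in_bisimilar G (tail G a) (tail G (\<sigma> a))) \<Longrightarrow>
   in_bisimilar G x y"

lemma in_bisimilar_refl: "in_bisimilar G x x"
proof (coinduction arbitrary: x)
  case in_bisimilar
  then show ?case
    by (intro exI[of _ id]) auto
qed

lemma in_bisimilarE:
  assumes "in_bisimilar G x y"
  obtains \<sigma> where "bij_betw \<sigma> (in_arcs G x) (in_arcs G y)"
    and "\<forall>a\<in>in_arcs G x. in_bisimilar G (tail G a) (tail G (\<sigma> a))"
  using assms by cases blast

lemma in_bisimilar_sym: "in_bisimilar G x y \<Longrightarrow> in_bisimilar G y x"
proof (coinduction arbitrary: x y)
  case in_bisimilar
  then obtain \<sigma> where bij: "bij_betw \<sigma> (in_arcs G x) (in_arcs G y)"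
    and tails: "\<forall>a\<in>in_arcs G x. in_bisimilar G (tail G a) (tail G (\<sigma> a))"
    by (rule in_bisimilarE)
  \<comment> \<open>Inverting \<open>\<sigma>\<close> pairs the tails in the opposite order, and the
    coinduction absorbs this swap.\<close>
  let ?\<rho> = "inv_into (in_arcs G x) \<sigma>"
  have "in_bisimilar G (tail G (?\<rho> a)) (tail G a)" if "a \<in> in_arcs G y" for a
    using bspec[OF tails bij_betw_apply[OF bij_betw_inv_into[OF bij] that]]
      bij_betw_inv_into_right[OF bij that] by metis
  with bij_betw_inv_into[OF bij] show ?case
    by (intro exI[of _ ?\<rho>] exI[of _ y] exI[of _ x]) (simp del: in_in_arcs_conv)
qed

lemma in_bisimilar_trans:
  "in_bisimilar G x y \<Longrightarrow> in_bisimilar G y z \<Longrightarrow> in_bisimilar G x z"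
proof (coinduction arbitrary: x y z)
  case in_bisimilar
  from in_bisimilar(1) obtain \<sigma> where \<sigma>: "bij_betw \<sigma> (in_arcs G x) (in_arcs G y)"
    and \<sigma>_tails: "\<forall>a\<in>in_arcs G x. in_bisimilar G (tail G a) (tail G (\<sigma> a))"
    by (rule in_bisimilarE)
  from in_bisimilar(2) obtain \<rho> where \<rho>: "bij_betw \<rho> (in_arcs G y) (in_arcs G z)"
    and \<rho>_tails: "\<forall>a\<in>in_arcs G y. in_bisimilar G (tail G a) (tail G (\<rho> a))"
    by (rule in_bisimilarE)
  have "bij_betw (\<rho> \<circ> \<sigma>) (in_arcs G x) (in_arcs G z)"
    using \<sigma> \<rho> by (rule bij_betw_trans)
  moreover have "\<sigma> a \<in> in_arcs G y" if "a \<in> in_arcs G x" for a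
    using \<sigma> that by (rule bij_betw_apply)
  \<comment> \<open>The tail of \<open>\<sigma> a\<close> is the intermediate node that keeps the
    coinduction going.\<close>
  then have "\<exists>v. in_bisimilar G (tail G a) v \<and> in_bisimilar G v (tail G ((\<rho> \<circ> \<sigma>) a))"
    if "a \<in> in_arcs G x" for a
    using \<sigma>_tails \<rho>_tails that by (metis comp_apply)
  ultimately show ?case
    by (intro exI[of _ "\<rho> \<circ> \<sigma>"] exI[of _ x] exI[of _ z]) (simp del: in_in_arcs_conv)
qed

section \<open>Basal graphs and the bisimilarity quotient\<close>

text \<open>Collapsing bisimilar nodes gives an epic covering from \<open>B\<close> to a quotient.
  Basality makes it an isomorphism, hence injective on nodes, so each bisimilarity class in
  \<open>verts B\<close> is a single node.\<close>

lemma basal_in_bisimilar_eq: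
  assumes "wf_digraph B" "basal B" "in_bisimilar B x y" "x \<in> verts B" "y \<in> verts B"
  shows "x = y"
proof -
  interpret wf_digraph B by fact
  \<comment> \<open>A chosen representative stands for each class, so that the quotient keeps the
    node and arc types of \<open>B\<close>, as \<open>basal\<close> requires.\<close>
  define r where "r x = (SOME z. z \<in> verts B \<and> in_bisimilar B x z)" for x
  have r: "r x \<in> verts B" "in_bisimilar B x (r x)" if "x \<in> verts B" for x
    using someI[of "\<lambda>z. z \<in> verts B \<and> in_bisimilar B x z" x] that in_bisimilar_refl[of B x]
    unfolding r_def by auto
  have r_eq: "r x = r y" if "in_bisimilar B x y" for x y
  proof -
    have "in_bisimilar B x z = in_bisimilar B y z" for z
      using that in_bisimilar_sym in_bisimilar_trans by metis
    then show ?thesis by (simp add: r_def)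
  qed
  have "\<exists>\<sigma>. bij_betw \<sigma> (in_arcs B x) (in_arcs B (r x)) \<and>
      (\<forall>a\<in>in_arcs B x. in_bisimilar B (tail B a) (tail B (\<sigma> a)))" if "x \<in> verts B" for x
    using r(2)[OF that] by (rule in_bisimilarE) blast
  then obtain \<sigma> where bij: "\<And>x. x \<in> verts B \<Longrightarrow> bij_betw (\<sigma> x) (in_arcs B x) (in_arcs B (r x))"
    and tails: "\<And>x a. x \<in> verts B \<Longrightarrow> a \<in> in_arcs B x \<Longrightarrow>
      in_bisimilar B (tail B a) (tail B (\<sigma> x a))"
    by metis
  \<comment> \<open>The arcs entering a class are those entering its representative, with their
    tails replaced by representatives.\<close>
  define Q where "Q = \<lparr>verts = r ` verts B, arcs = {a \<in> arcs B. head B a \<in> r ` verts B},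
    tail = r \<circ> tail B, head = head B\<rparr>"
  let ?f = "(r, \<lambda>a. \<sigma> (head B a) a)"
  have "wf_digraph Q"
    by unfold_locales (auto simp: Q_def)
  moreover have "epic_covering B Q ?f"
  proof -
    \<comment> \<open>The arc map applies the bijection chosen at the head. It need not preserve
      tails, only their classes, which suffices after \<open>r\<close>.\<close>
    have \<sigma>: "\<sigma> (head B a) a \<in> arcs B" "head B (\<sigma> (head B a) a) = r (head B a)"
      "r (tail B (\<sigma> (head B a) a)) = r (tail B a)" if "a \<in> arcs B" for a
      using bij_betw_apply[OF bij, of "head B a" a] tails[of "head B a" a] that r_eq by auto
    have "graph_morphism B Q ?f"
      unfolding graph_morphism_def by (auto simp: Q_def \<sigma>)
    moreover have "bij_betw (\<lambda>a. \<sigma> (head B a) a) (in_arcs B x) (in_arcs Q (r x))"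
      if "x \<in> verts B" for x
    proof -
      have "in_arcs Q (r x) = in_arcs B (r x)"
        using that by (auto simp: Q_def in_arcs_def)
      \<comment> \<open>All arcs in \<open>in_arcs B x\<close> have head \<open>x\<close>, so the
        global arc map restricts to \<open>\<sigma> x\<close>.\<close>
      moreover have "bij_betw (\<lambda>a. \<sigma> (head B a) a) (in_arcs B x) (in_arcs B (r x))
          \<longleftrightarrow> bij_betw (\<sigma> x) (in_arcs B x) (in_arcs B (r x))"
        by (rule bij_betw_cong) simp
      ultimately show ?thesis using bij[OF that] by simp
    qed
    ultimately show ?thesis by (simp add: epic_covering_def covering_def Q_def)
  qed
  ultimately have "graph_isomorphism B Q ?f"
    using assms(2) unfolding basal_def by blast
  then have "inj_on r (verts B)"
    by (simp add: graph_isomorphism_def bij_betw_def)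
  then show ?thesis using r_eq[OF assms(3)] assms(4,5) by (auto dest: inj_onD)
qed

section \<open>Walks and the fibres of the shift\<close>

lemma walks_iff:
  "\<omega> \<in> walks X \<longleftrightarrow> (\<forall>n. fst \<omega> n \<in> verts X \<and> snd \<omega> n \<in> arcs X \<and>
     tail X (snd \<omega> n) = fst \<omega> n \<and> head X (snd \<omega> n) = fst \<omega> (Suc n))"
  by (auto simp: walks_def graph_morphism_def nat_graph_def)

lemma shift_in_walks: "\<omega> \<in> walks X \<Longrightarrow> shift \<omega> \<in> walks X"
  by (simp add: walks_iff shift_def)

lemma tail_first_arc: "\<omega> \<in> walks X \<Longrightarrow> tail X (first_arc \<omega>) = walk_source \<omega>"
  by (simp add: walks_iff first_arc_def walk_source_def)

lemma walk_eqI: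
  assumes "walk_source \<omega> = walk_source \<omega>'" "first_arc \<omega> = first_arc \<omega>'" "shift \<omega> = shift \<omega>'"
  shows "\<omega> = \<omega>'"
proof (rule prod_eqI)
  show "fst \<omega> = fst \<omega>'"
  proof
    fix n show "fst \<omega> n = fst \<omega>' n"
      using assms by (cases n) (auto simp: walk_source_def shift_def fun_eq_iff)
  qed
  show "snd \<omega> = snd \<omega>'"
  proof
    fix n show "snd \<omega> n = snd \<omega>' n"
      using assms by (cases n) (auto simp: first_arc_def shift_def fun_eq_iff)
  qed
qed

text \<open>A predecessor of \<open>\<omega>\<close> under the shift is \<open>\<omega>\<close> with
  one arc prepended. The arc must end at the source of \<open>\<omega>\<close>, and its tail then
  supplies the new source.\<close>

lemma bij_betw_first_arc:
  assumes "wf_digraph X" "\<omega> \<in> walks X"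
  shows "bij_betw first_arc {\<nu> \<in> walks X. shift \<nu> = \<omega>} (in_arcs X (walk_source \<omega>))"
proof (rule bij_betw_imageI)
  interpret wf_digraph X by fact
  show "inj_on first_arc {\<nu> \<in> walks X. shift \<nu> = \<omega>}"
  proof (rule inj_onI, rule walk_eqI)
    fix \<nu> \<nu>' assume \<nu>: "\<nu> \<in> {\<nu> \<in> walks X. shift \<nu> = \<omega>}" "\<nu>' \<in> {\<nu> \<in> walks X. shift \<nu> = \<omega>}"
      and eq: "first_arc \<nu> = first_arc \<nu>'"
    then show "walk_source \<nu> = walk_source \<nu>'"
      using tail_first_arc[of \<nu> X] tail_first_arc[of \<nu>' X] by simp
    show "first_arc \<nu> = first_arc \<nu>'" by fact
    show "shift \<nu> = shift \<nu>'" using \<nu> by simp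
  qed
  show "first_arc ` {\<nu> \<in> walks X. shift \<nu> = \<omega>} = in_arcs X (walk_source \<omega>)"
  proof (intro equalityI subsetI)
    fix a assume "a \<in> first_arc ` {\<nu> \<in> walks X. shift \<nu> = \<omega>}"
    then show "a \<in> in_arcs X (walk_source \<omega>)"
      by (auto simp: walks_iff first_arc_def walk_source_def shift_def)
  next
    fix a assume a: "a \<in> in_arcs X (walk_source \<omega>)"
    define \<nu> where "\<nu> = (case_nat (tail X a) (fst \<omega>), case_nat a (snd \<omega>))"
    have "\<nu> \<in> walks X" unfolding walks_iff
    proof
      fix n show "fst \<nu> n \<in> verts X \<and> snd \<nu> n \<in> arcs X \<and>
        tail X (snd \<nu> n) = fst \<nu> n \<and> head X (snd \<nu> n) = fst \<nu> (Suc n)"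
        using assms(2) a by (cases n) (auto simp: \<nu>_def walks_iff walk_source_def)
    qed
    moreover have "shift \<nu> = \<omega>" "first_arc \<nu> = a"
      by (simp_all add: \<nu>_def shift_def first_arc_def)
    ultimately show "a \<in> first_arc ` {\<nu> \<in> walks X. shift \<nu> = \<omega>}" by blast
  qed
qed

text \<open>Since \<open>h\<close> commutes with the shift, it sends predecessors of
  \<open>\<omega>\<close> to predecessors of \<open>h \<omega>\<close>. Injectivity shows that the
  preimage of such a predecessor shifts to \<open>\<omega>\<close> again.\<close>

lemma nset_isomorphism_fibre:
  assumes "nset_isomorphism (walk_nset X) (walk_nset Y) h" "\<omega> \<in> walks X"
  shows "bij_betw h {\<nu> \<in> walks X. shift \<nu> = \<omega>} {\<nu> \<in> walks Y. shift \<nu> = h \<omega>}"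
proof -
  have bij: "bij_betw h (walks X) (walks Y)"
    and comm: "\<And>\<nu>. \<nu> \<in> walks X \<Longrightarrow> h (shift \<nu>) = shift (h \<nu>)"
    using assms(1) by (auto simp: nset_isomorphism_def nset_map_def walk_nset_def)
  have inj: "h (shift \<nu>) = h \<omega> \<longleftrightarrow> shift \<nu> = \<omega>" if "\<nu> \<in> walks X" for \<nu>
    using bij assms(2) shift_in_walks[OF that] by (metis bij_betw_imp_inj_on inj_onD)
  have "h ` {\<nu> \<in> walks X. shift \<nu> = \<omega>} = {\<nu> \<in> walks Y. shift \<nu> = h \<omega>}"
  proof (intro equalityI subsetI)
    fix \<nu> assume "\<nu> \<in> h ` {\<nu> \<in> walks X. shift \<nu> = \<omega>}"
    then show "\<nu> \<in> {\<nu> \<in> walks Y. shift \<nu> = h \<omega>}"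
      using bij comm by (fastforce simp: bij_betw_def)
  next
    fix \<nu> assume \<nu>: "\<nu> \<in> {\<nu> \<in> walks Y. shift \<nu> = h \<omega>}"
    then obtain \<mu> where "\<mu> \<in> walks X" "\<nu> = h \<mu>"
      using bij_betw_imp_surj_on[OF bij] by (metis (lifting) CollectD imageE)
    then show "\<nu> \<in> h ` {\<nu> \<in> walks X. shift \<nu> = \<omega>}" using \<nu> inj comm by auto
  qed
  then show ?thesis using bij by (auto simp: bij_betw_def intro: inj_on_subset)
qed

section \<open>How an isomorphism of N-sets acts on nodes\<close>

text \<open>The predecessors of \<open>\<omega>\<close> correspond to the arcs entering its source
  in \<open>X\<close> and, through \<open>h\<close>, to the arcs entering the source of
  \<open>h \<omega>\<close> in \<open>Y\<close>. Equal sources therefore let the fibres over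
  \<open>\<omega>\<close> and \<open>\<omega>'\<close> be matched through common arcs of
  \<open>X\<close>.\<close>

lemma nset_isomorphism_in_bisimilar:
  assumes "wf_digraph X" "wf_digraph Y" and iso: "nset_isomorphism (walk_nset X) (walk_nset Y) h"
    and "\<omega> \<in> walks X" "\<omega>' \<in> walks X" "walk_source \<omega> = walk_source \<omega>'"
  shows "in_bisimilar Y (walk_source (h \<omega>)) (walk_source (h \<omega>'))"
  using assms(4-6)
proof (coinduction arbitrary: \<omega> \<omega>')
  case in_bisimilar
  define F where "F \<omega> = {\<nu> \<in> walks X. shift \<nu> = \<omega>}" for \<omega>
  have walks: "h \<nu> \<in> walks Y" if "\<nu> \<in> walks X" for \<nu>
    using iso that by (auto simp: nset_isomorphism_def nset_map_def walk_nset_def)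
  have X: "bij_betw first_arc (F \<nu>) (in_arcs X (walk_source \<nu>))" if "\<nu> \<in> walks X" for \<nu>
    unfolding F_def using assms(1) that by (rule bij_betw_first_arc)
  have Y: "bij_betw (first_arc \<circ> h) (F \<nu>) (in_arcs Y (walk_source (h \<nu>)))" if "\<nu> \<in> walks X" for \<nu>
    using nset_isomorphism_fibre[OF iso that] bij_betw_first_arc[OF assms(2) walks[OF that]]
    unfolding F_def by (rule bij_betw_trans)
  define p where "p = inv_into (F \<omega>) (first_arc \<circ> h)"
  define q where "q = inv_into (F \<omega>') first_arc"
  \<comment> \<open>An arc of \<open>Y\<close> selects through \<open>p\<close> a predecessor of
    \<open>\<omega>\<close>, whose first arc is prepended to \<open>\<omega>'\<close> by
    \<open>q\<close>. Then \<open>h\<close> carries the result back to \<open>Y\<close>, where the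
    first arc is taken.\<close>
  define \<sigma> where "\<sigma> = (first_arc \<circ> h) \<circ> (q \<circ> (first_arc \<circ> p))"
  have p: "bij_betw p (in_arcs Y (walk_source (h \<omega>))) (F \<omega>)"
    unfolding p_def by (rule bij_betw_inv_into[OF Y]) fact
  have q: "bij_betw q (in_arcs X (walk_source \<omega>')) (F \<omega>')"
    unfolding q_def by (rule bij_betw_inv_into[OF X]) fact
  have fp: "bij_betw (first_arc \<circ> p) (in_arcs Y (walk_source (h \<omega>))) (in_arcs X (walk_source \<omega>'))"
    using bij_betw_trans[OF p X] in_bisimilar by simp
  have bij: "bij_betw \<sigma> (in_arcs Y (walk_source (h \<omega>))) (in_arcs Y (walk_source (h \<omega>')))"
    unfolding \<sigma>_def using bij_betw_trans[OF bij_betw_trans[OF fp q] Y] in_bisimilar by simp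
  \<comment> \<open>The two matched predecessors start with the same arc of \<open>X\<close>, hence
    at the same node, so they satisfy the coinduction invariant again.\<close>
  have "\<exists>\<nu> \<nu>'. tail Y a = walk_source (h \<nu>) \<and> tail Y (\<sigma> a) = walk_source (h \<nu>') \<and>
      \<nu> \<in> walks X \<and> \<nu>' \<in> walks X \<and> walk_source \<nu> = walk_source \<nu>'"
    if a: "a \<in> in_arcs Y (walk_source (h \<omega>))" for a
  proof (rule exI[of _ "p a"], rule exI[of _ "q (first_arc (p a))"], intro conjI)
    have e: "first_arc (p a) \<in> in_arcs X (walk_source \<omega>')"
      using bij_betw_apply[OF fp a] by simp
    show pX: "p a \<in> walks X" using bij_betw_apply[OF p a] by (simp add: F_def)
    show qX: "q (first_arc (p a)) \<in> walks X"
      using bij_betw_apply[OF q e] by (simp add: F_def)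
    have "first_arc (h (p a)) = a"
      using bij_betw_inv_into_right[OF Y[OF in_bisimilar(1)] a] by (simp add: p_def)
    then show "tail Y a = walk_source (h (p a))" using tail_first_arc[OF walks[OF pX]] by simp
    show "tail Y (\<sigma> a) = walk_source (h (q (first_arc (p a))))"
      using tail_first_arc[OF walks[OF qX]] by (simp add: \<sigma>_def)
    have "first_arc (q (first_arc (p a))) = first_arc (p a)"
      using bij_betw_inv_into_right[OF X[OF in_bisimilar(2)] e] by (simp add: q_def)
    then show "walk_source (p a) = walk_source (q (first_arc (p a)))"
      using tail_first_arc[OF pX] tail_first_arc[OF qX] by simp
  qed
  with bij show ?case by blast
qed

text \<open>Turns claims about the node at position \<open>n\<close> into claims about
  sources.\<close>

lemma walk_source_funpow_shift: "walk_source ((shift ^^ n) \<omega>) = fst \<omega> n"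
  by (induction n arbitrary: \<omega>) (simp_all add: walk_source_def shift_def funpow_Suc_right del: funpow.simps)

lemma nset_map_funpow_shift:
  assumes "nset_map (walk_nset X) (walk_nset Y) h" "\<omega> \<in> walks X"
  shows "(shift ^^ n) \<omega> \<in> walks X \<and> h ((shift ^^ n) \<omega>) = (shift ^^ n) (h \<omega>)"
  using assms by (induction n) (auto simp: nset_map_def walk_nset_def shift_in_walks)

text \<open>Shifting \<open>n\<close> times reduces the claim to position \<open>0\<close>. There
  the images have bisimilar sources, and these are equal because \<open>B\<close> is basal.\<close>

lemma nset_isomorphism_nodes:
  assumes "wf_digraph X" "wf_digraph B" "basal B"
    and iso: "nset_isomorphism (walk_nset X) (walk_nset B) h"
    and "\<omega> \<in> walks X" "\<omega>' \<in> walks X" "fst \<omega> n = fst \<omega>' n"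
  shows "fst (h \<omega>) n = fst (h \<omega>') n"
proof -
  have map: "nset_map (walk_nset X) (walk_nset B) h"
    using iso by (simp add: nset_isomorphism_def)
  have source: "walk_source (h \<nu>) \<in> verts B" if "\<nu> \<in> walks X" for \<nu>
  proof -
    have "h \<nu> \<in> walks B" using map that by (auto simp: nset_map_def walk_nset_def)
    then show ?thesis by (simp add: walks_iff walk_source_def)
  qed
  let ?\<nu> = "(shift ^^ n) \<omega>" and ?\<nu>' = "(shift ^^ n) \<omega>'"
  have \<nu>: "?\<nu> \<in> walks X" "?\<nu>' \<in> walks X" "walk_source ?\<nu> = walk_source ?\<nu>'"
    using nset_map_funpow_shift[OF map] assms(5-7) by (simp_all add: walk_source_funpow_shift)
  have "walk_source (h ?\<nu>) = walk_source (h ?\<nu>')"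
    using nset_isomorphism_in_bisimilar[OF assms(1,2) iso \<nu>] source \<nu>
    by (intro basal_in_bisimilar_eq[OF assms(2,3)]) auto
  then show ?thesis
    using nset_map_funpow_shift[OF map] assms(5,6) by (simp add: walk_source_funpow_shift)
qed

section \<open>Continuity from the absence of parallel arcs\<close>

text \<open>Both arcs run between the same consecutive nodes, and \<open>B\<close> has no parallel
  arcs.\<close>

lemma nomulti_walk_arc_eq:
  assumes "nomulti_digraph B" "\<omega> \<in> walks B" "\<omega>' \<in> walks B"
    and "fst \<omega> n = fst \<omega>' n" "fst \<omega> (Suc n) = fst \<omega>' (Suc n)"
  shows "snd \<omega> n = snd \<omega>' n"
proof -
  interpret nomulti_digraph B by fact
  have \<omega>: "snd \<omega> n \<in> arcs B" "arc_to_ends B (snd \<omega> n) = (fst \<omega> n, fst \<omega> (Suc n))"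
    if "\<omega> \<in> walks B" for \<omega>
    using that by (simp_all add: walks_iff arc_to_ends_def)
  show ?thesis
    using no_multi_arcs[OF \<omega>(1)[OF assms(2)] \<omega>(1)[OF assms(3)]] \<omega>(2)[OF assms(2)] \<omega>(2)[OF assms(3)]
      assms(4,5) by metis
qed

text \<open>Agreement of two walks up to step \<open>n\<close> passes to their images without loss:
  nodes are transported position by position, and in \<open>B\<close> they determine the
  arcs.\<close>

lemma nset_isomorphism_continuous:
  assumes "wf_digraph X" "nomulti_digraph B" "basal B"
    and iso: "nset_isomorphism (walk_nset X) (walk_nset B) h"
  shows "continuous_map (walk_topology X) (walk_topology B) h"
proof -
  interpret B: nomulti_digraph B by fact
  have h: "h \<omega> \<in> walks B" if "\<omega> \<in> walks X" for \<omega>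
    using iso that by (auto simp: nset_isomorphism_def nset_map_def walk_nset_def)
  have nbhd: "h \<omega>' \<in> walk_nbhd B n (h \<omega>)" if "\<omega> \<in> walks X" "\<omega>' \<in> walk_nbhd X n \<omega>" for \<omega> \<omega>' n
  proof -
    have \<omega>': "\<omega>' \<in> walks X" using that by (simp add: walk_nbhd_def)
    have nodes: "fst (h \<omega>') i = fst (h \<omega>) i" if "i \<le> n" for i
      using that \<open>\<omega>' \<in> walk_nbhd X n \<omega>\<close>
      by (intro nset_isomorphism_nodes[OF assms(1) B.wf_digraph_axioms assms(3) iso \<omega>' \<open>\<omega> \<in> walks X\<close>])
        (simp add: walk_nbhd_def)
    \<comment> \<open>Both ends of arc \<open>i\<close> are among the nodes up to
      \<open>n\<close>.\<close>
    have "snd (h \<omega>') i = snd (h \<omega>) i" if "i < n" for i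
      using that by (intro nomulti_walk_arc_eq[OF assms(2) h[OF \<omega>'] h[OF \<open>\<omega> \<in> walks X\<close>]] nodes) auto
    with nodes show ?thesis using h[OF \<omega>'] by (simp add: walk_nbhd_def)
  qed
  show ?thesis unfolding continuous_map topspace_walk_topology
  proof (intro conjI allI impI)
    show "h ` walks X \<subseteq> walks B" using h by blast
    fix U assume "openin (walk_topology B) U"
    then have U: "\<exists>n. walk_nbhd B n \<omega> \<subseteq> U" if "\<omega> \<in> U" for \<omega>
      using that by (simp add: openin_walk_topology)
    show "openin (walk_topology X) {\<omega> \<in> walks X. h \<omega> \<in> U}"
      unfolding openin_walk_topology
    proof (intro conjI ballI)
      fix \<omega> assume \<omega>: "\<omega> \<in> {\<omega> \<in> walks X. h \<omega> \<in> U}"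
      then obtain n where "walk_nbhd B n (h \<omega>) \<subseteq> U" using U by blast
      moreover have "walk_nbhd X n \<omega> \<subseteq> walks X" by (auto simp: walk_nbhd_def)
      ultimately have "walk_nbhd X n \<omega> \<subseteq> {\<omega> \<in> walks X. h \<omega> \<in> U}"
        using nbhd \<omega> by blast
      then show "\<exists>n. walk_nbhd X n \<omega> \<subseteq> {\<omega> \<in> walks X. h \<omega> \<in> U}" ..
    qed blast
  qed
qed

section \<open>The walk space is Hausdorff and, for finite graphs, compact\<close>

lemma Hausdorff_walk_topology: "Hausdorff_space (walk_topology X)"
  unfolding Hausdorff_space_def topspace_walk_topology
proof (intro allI impI, elim conjE)
  fix \<omega> \<omega>' assume \<omega>: "\<omega> \<in> walks X" "\<omega>' \<in> walks X" "\<omega> \<noteq> \<omega>'"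
  obtain n where n: "fst \<omega> n \<noteq> fst \<omega>' n \<or> snd \<omega> n \<noteq> snd \<omega>' n"
    using \<omega>(3) by (auto simp: prod_eq_iff fun_eq_iff)
  show "\<exists>U V. openin (walk_topology X) U \<and> openin (walk_topology X) V \<and>
      \<omega> \<in> U \<and> \<omega>' \<in> V \<and> disjnt U V"
  proof (intro exI conjI)
    \<comment> \<open>The radius is \<open>Suc n\<close> because \<open>walk_nbhd X n\<close>
      constrains arcs only below \<open>n\<close>.\<close>
    show "openin (walk_topology X) (walk_nbhd X (Suc n) \<omega>)"
      "openin (walk_topology X) (walk_nbhd X (Suc n) \<omega>')"
      unfolding walk_topology_def using \<omega>(1,2) by (blast intro: topology_generated_by_Basis)+
    show "\<omega> \<in> walk_nbhd X (Suc n) \<omega>" "\<omega>' \<in> walk_nbhd X (Suc n) \<omega>'"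
      using \<omega>(1,2) by (simp_all add: walk_nbhd_self)
    have False if "\<nu> \<in> walk_nbhd X (Suc n) \<omega>" "\<nu> \<in> walk_nbhd X (Suc n) \<omega>'" for \<nu>
    proof -
      have "fst \<nu> n = fst \<omega> n" "snd \<nu> n = snd \<omega> n" "fst \<nu> n = fst \<omega>' n" "snd \<nu> n = snd \<omega>' n"
        using that by (simp_all add: walk_nbhd_def)
      with n show False by simp
    qed
    then show "disjnt (walk_nbhd X (Suc n) \<omega>) (walk_nbhd X (Suc n) \<omega>')"
      unfolding disjnt_iff by blast
  qed
qed

text \<open>The walks are the continuous image of a closed set of arc sequences, by Tychonoff compact.\<close>

lemma compact_walk_topology:
  assumes "fin_digraph X"
  shows "compact_space (walk_topology X)"
proof -
  interpret fin_digraph X by fact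
  \<comment> \<open>Arcs alone suffice as coordinates, since the nodes of a walk are the tails of
    its arcs. Finiteness of \<open>arcs X\<close> makes each discrete factor compact.\<close>
  define P where "P = product_topology (\<lambda>_::nat. discrete_topology (arcs X)) UNIV"
  define S where "S = {e \<in> topspace P. \<forall>n. head X (e n) = tail X (e (Suc n))}"
  define g where "g e = ((\<lambda>n. tail X (e n)), e)" for e :: "nat \<Rightarrow> 'b"
  have top: "e \<in> topspace P \<longleftrightarrow> (\<forall>n. e n \<in> arcs X)" for e
    by (auto simp: P_def PiE_iff)
  have proj: "continuous_map P (discrete_topology (arcs X)) (\<lambda>e. e n)" for n
    unfolding P_def by (rule continuous_map_product_projection) simp
  have coord: "openin P {e \<in> topspace P. e n \<in> A}" if "A \<subseteq> arcs X" for n A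
    using openin_continuous_map_preimage[OF proj, of A] that by simp
  \<comment> \<open>These cylinders serve twice: for the closedness of \<open>S\<close> and for the
    continuity of \<open>g\<close>.\<close>
  have cyl: "openin P {e \<in> topspace P. \<forall>i\<le>n. e i = c i}" if "\<And>i. c i \<in> arcs X" for n c
  proof (induction n)
    case 0
    then show ?case using coord[of "{c 0}" 0] that by simp
  next
    case (Suc n)
    have "{e \<in> topspace P. \<forall>i\<le>Suc n. e i = c i} =
        {e \<in> topspace P. \<forall>i\<le>n. e i = c i} \<inter> {e \<in> topspace P. e (Suc n) \<in> {c (Suc n)}}"
      by (auto simp: le_Suc_eq)
    then show ?case using Suc coord[of "{c (Suc n)}" "Suc n"] that by (simp add: openin_Int)
  qed
  have "compact_space P"
    unfolding P_def by (simp add: compact_space_product_topology compact_space_discrete_topology)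
  \<comment> \<open>A failure to compose at position \<open>n\<close> is visible in the coordinates
    \<open>n\<close> and \<open>n + 1\<close> alone, so it persists on a whole cylinder.\<close>
  moreover have "openin P (topspace P - S)"
  proof (subst openin_subopen, intro ballI)
    fix e assume e: "e \<in> topspace P - S"
    then obtain n where n: "head X (e n) \<noteq> tail X (e (Suc n))" by (auto simp: S_def)
    let ?T = "{e' \<in> topspace P. \<forall>i\<le>Suc n. e' i = e i}"
    have "openin P ?T" using e by (intro cyl) (simp add: top)
    moreover have "e' \<notin> S" if "e' \<in> ?T" for e'
    proof -
      have "e' n = e n" "e' (Suc n) = e (Suc n)" using that by simp_all
      then have "head X (e' n) \<noteq> tail X (e' (Suc n))" using n by simp
      then show ?thesis unfolding S_def by blast
    qed
    then have "?T \<subseteq> topspace P - S" by blast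
    ultimately show "\<exists>T. openin P T \<and> e \<in> T \<and> T \<subseteq> topspace P - S" using e by blast
  qed
  then have "closedin P S" by (simp add: closedin_def S_def)
  ultimately have "compactin P S" by (rule closedin_compact_space)
  then have "compactin (subtopology P S) S" by (simp add: compactin_subtopology)
  moreover have gS: "g ` S = walks X"
  proof (intro equalityI subsetI)
    fix \<omega> assume "\<omega> \<in> walks X"
    then have "\<omega> = g (snd \<omega>)" "snd \<omega> \<in> S"
      by (auto simp: walks_iff g_def S_def top intro: prod_eqI)
    then show "\<omega> \<in> g ` S" by blast
  qed (auto simp: walks_iff g_def S_def top)
  have "continuous_map (subtopology P S) (walk_topology X) g"
    unfolding continuous_map topspace_walk_topology
  proof (intro conjI allI impI)
    show "g ` topspace (subtopology P S) \<subseteq> walks X" using gS by auto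
    fix U assume "openin (walk_topology X) U"
    then have U: "\<exists>n. walk_nbhd X n \<omega> \<subseteq> U" if "\<omega> \<in> U" for \<omega>
      using that by (simp add: openin_walk_topology)
    show "openin (subtopology P S) {e \<in> topspace (subtopology P S). g e \<in> U}"
    proof (subst openin_subopen, intro ballI)
      fix e assume e: "e \<in> {e \<in> topspace (subtopology P S). g e \<in> U}"
      then obtain n where n: "walk_nbhd X n (g e) \<subseteq> U" using U by blast
      \<comment> \<open>The arcs \<open>0\<close> to \<open>n\<close> fix the nodes \<open>0\<close>
        to \<open>n\<close>, as their tails, and all arcs below \<open>n\<close>, which is what
        \<open>walk_nbhd X n\<close> asks for.\<close>
      let ?T = "{e' \<in> topspace P. \<forall>i\<le>n. e' i = e i}"
      have "openin P ?T" using e by (intro cyl) (simp add: top)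
      then have "openin (subtopology P S) (?T \<inter> S)" by (auto simp: openin_subtopology)
      moreover have "g e' \<in> walk_nbhd X n (g e)" if "e' \<in> ?T \<inter> S" for e'
        using that gS by (auto simp: walk_nbhd_def g_def)
      then have "?T \<inter> S \<subseteq> {e \<in> topspace (subtopology P S). g e \<in> U}" using n by auto
      ultimately show "\<exists>T. openin (subtopology P S) T \<and> e \<in> T \<and>
          T \<subseteq> {e \<in> topspace (subtopology P S). g e \<in> U}"
        using e by (intro exI[of _ "?T \<inter> S"]) auto
    qed
  qed
  ultimately have "compactin (walk_topology X) (g ` S)" by (rule image_compactin)
  then show ?thesis by (simp add: gS compact_space_def topspace_walk_topology)
qed

theorem mainTheorem7:
  fixes X :: "('a, 'b) pre_digraph" and B :: "('c, 'd) pre_digraph"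
  assumes "fin_digraph X" and "walkable X"
    and "fin_digraph B" and "walkable B"
    and "nomulti_digraph B" and "basal B"
  shows "topologically_N_equivalent X B \<longleftrightarrow> N_equivalent X B"
proof
  assume "topologically_N_equivalent X B"
  then show "N_equivalent X B" by (auto simp: topologically_N_equivalent_def N_equivalent_def)
next
  interpret X: fin_digraph X by fact
  assume "N_equivalent X B"
  then obtain h where iso: "nset_isomorphism (walk_nset X) (walk_nset B) h"
    by (auto simp: N_equivalent_def)
  have "continuous_map (walk_topology X) (walk_topology B) h"
    by (rule nset_isomorphism_continuous[OF X.wf_digraph_axioms assms(5,6) iso])
  moreover have "bij_betw h (walks X) (walks B)"
    using iso by (simp add: nset_isomorphism_def walk_nset_def)
  \<comment> \<open>Finiteness of \<open>X\<close> makes the domain compact, which yields continuity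
    of the inverse.\<close>
  ultimately have "homeomorphic_map (walk_topology X) (walk_topology B) h"
    using compact_walk_topology[OF assms(1)] Hausdorff_walk_topology
    by (intro continuous_imp_homeomorphic_map) (auto simp: bij_betw_def topspace_walk_topology)
  with iso show "topologically_N_equivalent X B"
    by (auto simp: topologically_N_equivalent_def)
qed

end
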